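(* Let $G=(V,E)$ be a digraph and let $a,b\in V$ be two vertices. (i) If $(a\to b)\notin E$, then the restrictions of the homomorphisms $\pi^{[a,b]}$ define a morphism of chain complexes (of degree $-2$) $\pi^{[a,b]}\colon\Theta_n^{[a,b]}(G)\to\Pi_{n-2}(G)$, $n\ge1$. (ii) If $(a\to b)\in E$, then the restrictions of the homomorphisms $\pi^{[a,b]}$ define a morphism of chain complexes (of degree $-2$) $\pi^{[a,b]}\colon\Theta_n^{[a,b]}(G)\to\widetilde\Pi_{n-2}(G)$, $n\ge1$.
   Context: Fix a commutative ring $R$ with unit. A digraph $G=(V,E)$ is a finite nonempty set $V$ of vertices with a set $E$ of ordered pairs $(v,w)$ of distinct vertices, written $v\to w$ (arrows). For $n\ge 0$, $\Lambda_n(V)$ is the free $R$-module with basis the elements $e_{i_0\dots i_n}$, one for each sequence $(i_0,\dots,i_n)$ of elements of $V$; $\Lambda_{-1}(V)=0$. The differential $\partial\colon\Lambda_n(V)\to\Lambda_{n-1}(V)$ is $\partial(e_{i_0\dots i_n})=\sum_{m=0}^n(-1)^m e_{i_0\dots\widehat{i_m}\dots i_n}$ for $n\ge1$, and $0$ for $n=0$. $e_{i_0\dots i_n}$ is allowed in $G$ if $(i_k\to i_{k+1})\in E$ for all $0\le k\le n-1$ (every $e_{i_0}$ is allowed). $\mathcal A_n(G)\subset\Lambda_n(V)$ is the submodule generated by allowed elementary $n$-paths; $\mathcal A_{-1}(G)=0$. $\Pi_n(G)=\{w\in\mathcal A_n(G)\mid\partial w\in\mathcal A_{n-1}(G)\}$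 for $n\ge 0$, $\Pi_{-1}(G)=0$; this is a chain complex with differential $\partial$. Augmented complexes: $\widetilde\Lambda_*(V)$ has $\widetilde\Lambda_n=\Lambda_n(V)$ for $n\ge0$, $\widetilde\Lambda_{-1}=R$, $\widetilde\Lambda_n=0$ for $n\le-2$, with differential $\partial$ in degrees $\ge1$ and $\varepsilon\colon\Lambda_0(V)\to R$, $\varepsilon(\sum r^ie_i)=\sum r^i$, in degree $0$. $\widetilde\Pi_*(G)$ is defined in the same way: $\widetilde\Pi_n=\Pi_n(G)$ for $n\ge0$, $\widetilde\Pi_{-1}=R$, with $\varepsilon$ in degree $0$. For $n\ge1$, $\Lambda_n^{[a,b]}(V)\subset\Lambda_n(V)$ is the free submodule generated by the $e_{i_0\dots i_n}$ with $i_0=a$, $i_n=b$; $\Lambda_0^{[a,b]}(V)=0$. The differential $d\colon\Lambda_n^{[a,b]}\to\Lambda_{n-1}^{[a,b]}$ is $d(e_{ai_0\dots i_{n-2}b})=\sum_{m=0}^{n-2}(-1)^me_{ai_0\dots\widehat{i_m}\dots i_{n-2}b}$ for $n\ge2$ and $d=0$ for $n=1$. $\mathcal A_n^{[a,b]}(G)\subset\Lambda_n^{[a,b]}(V)$ is the submodule generated by the allowed elementary $n$-paths from $a$ to $b$ for $n\ge 1$, and $\mathcal A_0^{[a,b]}(G)=0$. $\Theta_n^{[a,b]}(G)=\{w\in\mathcal A_n^{[a,b]}(G)\mid d(w)\in\mathcal A_{n-1}^{[a,b]}(G)\}$ for $n\ge1$, $\Theta_0^{[a,b]}(G)=0$;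 this is a chain complex with differential $d$. The isomorphism $\pi^{[a,b]}\colon\Lambda_n^{[a,b]}(V)\to\widetilde\Lambda_{n-2}(V)$ is given by $\pi^{[a,b]}(e_{ai_0\dots i_{n-2}b})=e_{i_0\dots i_{n-2}}$ for $n\ge2$, $\pi^{[a,b]}(e_{ab})=1\in R$ for $n=1$, and $\pi^{[a,b]}=0$ for $n=0$. *)

theory Defs
  imports "Graph_Theory.Pair_Digraph" "HOL-Library.Poly_Mapping"
begin

text \<open>
  The coefficient ring is a type of sort \<open>{comm_ring, comm_monoid_mult}\<close>: a commutative ring
  with unit, where (in contrast to \<^class>\<open>comm_ring_1\<close>) the zero ring is not excluded.

  Elements of path modules are finitely supported functions on vertex sequences. All degrees live
  in the one type \<open>'v list \<Rightarrow>\<^sub>0 'r\<close>, a sequence of length \<open>n + 1\<close> being in degree \<open>n\<close>. The empty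
  sequence is in degree \<open>-1\<close>; its multiples are the copy of the ring \<open>R\<close> that an augmented
  complex has there.
\<close>

type_synonym ('v, 'r) chain = "'v list \<Rightarrow>\<^sub>0 'r"

definition scale :: "'r \<Rightarrow> ('x \<Rightarrow>\<^sub>0 'r) \<Rightarrow> ('x \<Rightarrow>\<^sub>0 'r::{comm_ring,comm_monoid_mult})" where
  "scale r w = Poly_Mapping.map (\<lambda>s. r * s) w"

definition is_submodule :: "('x \<Rightarrow>\<^sub>0 'r::{comm_ring,comm_monoid_mult}) set \<Rightarrow> bool" where
  "is_submodule M \<longleftrightarrow>
     0 \<in> M \<and> (\<forall>x\<in>M. \<forall>y\<in>M. x + y \<in> M) \<and> (\<forall>r. \<forall>x\<in>M. scale r x \<in> M)"

definition generated ::
  "('x \<Rightarrow>\<^sub>0 'r) set \<Rightarrow> ('x \<Rightarrow>\<^sub>0 'r::{comm_ring,comm_monoid_mult}) set" where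
  "generated S = is_submodule hull S"

definition linear_map ::
  "('x \<Rightarrow>\<^sub>0 'r) set \<Rightarrow> ('y \<Rightarrow>\<^sub>0 'r) set \<Rightarrow>
   (('x \<Rightarrow>\<^sub>0 'r) \<Rightarrow> ('y \<Rightarrow>\<^sub>0 'r::{comm_ring,comm_monoid_mult})) \<Rightarrow> bool" where
  "linear_map M N f \<longleftrightarrow>
     (\<forall>x\<in>M. f x \<in> N) \<and> (\<forall>x\<in>M. \<forall>y\<in>M. f (x + y) = f x + f y) \<and>
     (\<forall>r. \<forall>x\<in>M. f (scale r x) = scale r (f x))"

definition linear_extension ::
  "('x \<Rightarrow> ('y \<Rightarrow>\<^sub>0 'r)) \<Rightarrow> ('x \<Rightarrow>\<^sub>0 'r) \<Rightarrow> ('y \<Rightarrow>\<^sub>0 'r::{comm_ring,comm_monoid_mult})" where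
  "linear_extension f w = (\<Sum>x\<in>Poly_Mapping.keys w. scale (Poly_Mapping.lookup w x) (f x))"

text \<open>
  Complexes are indexed by all integers. \<open>C n\<close> is the module in degree \<open>n\<close>, and \<open>d n\<close> is the
  differential from degree \<open>n\<close> to degree \<open>n - 1\<close>; only its values on \<open>C n\<close> matter.
\<close>

definition chain_complex ::
  "(int \<Rightarrow> ('x \<Rightarrow>\<^sub>0 'r) set) \<Rightarrow>
   (int \<Rightarrow> ('x \<Rightarrow>\<^sub>0 'r) \<Rightarrow> ('x \<Rightarrow>\<^sub>0 'r::{comm_ring,comm_monoid_mult})) \<Rightarrow> bool" where
  "chain_complex C d \<longleftrightarrow>
     (\<forall>n. is_submodule (C n) \<and> linear_map (C n) (C (n - 1)) (d n) \<and>
          (\<forall>x\<in>C n. d (n - 1) (d n x) = 0))"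

definition chain_morphism ::
  "int \<Rightarrow> (int \<Rightarrow> ('x \<Rightarrow>\<^sub>0 'r) set) \<Rightarrow> (int \<Rightarrow> ('x \<Rightarrow>\<^sub>0 'r) \<Rightarrow> ('x \<Rightarrow>\<^sub>0 'r)) \<Rightarrow>
   (int \<Rightarrow> ('y \<Rightarrow>\<^sub>0 'r) set) \<Rightarrow> (int \<Rightarrow> ('y \<Rightarrow>\<^sub>0 'r) \<Rightarrow> ('y \<Rightarrow>\<^sub>0 'r)) \<Rightarrow>
   (int \<Rightarrow> ('x \<Rightarrow>\<^sub>0 'r) \<Rightarrow> ('y \<Rightarrow>\<^sub>0 'r::{comm_ring,comm_monoid_mult})) \<Rightarrow> bool" where
  "chain_morphism k C d C' d' f \<longleftrightarrow>
     chain_complex C d \<and> chain_complex C' d' \<and>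
     (\<forall>n. linear_map (C n) (C' (n + k)) (f n) \<and>
          (\<forall>x\<in>C n. d' (n + k) (f n x) = f (n - 1) (d n x)))"

definition elem_path :: "'v list \<Rightarrow> ('v, 'r::{comm_ring,comm_monoid_mult}) chain" where
  "elem_path xs = Poly_Mapping.single xs 1"

definition omit :: "nat \<Rightarrow> 'v list \<Rightarrow> 'v list" where
  "omit m xs = take m xs @ drop (Suc m) xs"

definition seqs :: "'v set \<Rightarrow> int \<Rightarrow> 'v list set" where
  "seqs V n = {xs. n \<ge> 0 \<and> set xs \<subseteq> V \<and> int (length xs) = n + 1}"

definition allowed :: "'v pair_pre_digraph \<Rightarrow> 'v list \<Rightarrow> bool" where
  "allowed G xs \<longleftrightarrow> (\<forall>k. Suc k < length xs \<longrightarrow> (xs ! k, xs ! Suc k) \<in> parcs G)"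

definition boundary ::
  "int \<Rightarrow> ('v, 'r) chain \<Rightarrow> ('v, 'r::{comm_ring,comm_monoid_mult}) chain" where
  "boundary n w =
     (if n \<ge> 1 then linear_extension (\<lambda>xs. \<Sum>m=0..nat n. scale ((-1) ^ m) (elem_path (omit m xs))) w
      else 0)"

definition allowed_paths :: "'v pair_pre_digraph \<Rightarrow> int \<Rightarrow> ('v, 'r::{comm_ring,comm_monoid_mult}) chain set"
  where "allowed_paths G n = generated (elem_path ` {xs \<in> seqs (pverts G) n. allowed G xs})"

definition Pi_cx ::
  "'v pair_pre_digraph \<Rightarrow> int \<Rightarrow> ('v, 'r::{comm_ring,comm_monoid_mult}) chain set" where
  "Pi_cx G n = (if n \<ge> 0 then {w \<in> allowed_paths G n. boundary n w \<in> allowed_paths G (n - 1)} else {0})"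

definition ring_elem :: "'r \<Rightarrow> ('v, 'r::{comm_ring,comm_monoid_mult}) chain" where
  "ring_elem r = Poly_Mapping.single [] r"

definition augmentation :: "('v, 'r::{comm_ring,comm_monoid_mult}) chain \<Rightarrow> 'r" where
  "augmentation w = (\<Sum>x\<in>Poly_Mapping.keys w. Poly_Mapping.lookup w x)"

definition boundary_aug ::
  "int \<Rightarrow> ('v, 'r) chain \<Rightarrow> ('v, 'r::{comm_ring,comm_monoid_mult}) chain" where
  "boundary_aug n w = (if n = 0 then ring_elem (augmentation w) else boundary n w)"

definition Pi_aug ::
  "'v pair_pre_digraph \<Rightarrow> int \<Rightarrow> ('v, 'r::{comm_ring,comm_monoid_mult}) chain set" where
  "Pi_aug G n = (if n \<ge> 0 then Pi_cx G n else if n = -1 then range ring_elem else {0})"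

definition seqs_between :: "'v set \<Rightarrow> 'v \<Rightarrow> 'v \<Rightarrow> int \<Rightarrow> 'v list set" where
  "seqs_between V a b n = {xs \<in> seqs V n. n \<ge> 1 \<and> hd xs = a \<and> last xs = b}"

text \<open>
  In \<open>a i\<^sub>0 \<dots> i\<^sub>n\<^sub>-\<^sub>2 b\<close> the vertex \<open>i\<^sub>m\<close> is at position \<open>m + 1\<close>, whence the \<open>Suc\<close> below.
\<close>

definition diff_between ::
  "int \<Rightarrow> ('v, 'r) chain \<Rightarrow> ('v, 'r::{comm_ring,comm_monoid_mult}) chain" where
  "diff_between n w =
     (if n \<ge> 2
      then linear_extension
             (\<lambda>xs. \<Sum>m=0..nat (n - 2). scale ((-1) ^ m) (elem_path (omit (Suc m) xs))) w
      else 0)"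

definition allowed_between ::
  "'v pair_pre_digraph \<Rightarrow> 'v \<Rightarrow> 'v \<Rightarrow> int \<Rightarrow> ('v, 'r::{comm_ring,comm_monoid_mult}) chain set"
  where "allowed_between G a b n = generated (elem_path ` {xs \<in> seqs_between (pverts G) a b n. allowed G xs})"

definition Theta ::
  "'v pair_pre_digraph \<Rightarrow> 'v \<Rightarrow> 'v \<Rightarrow> int \<Rightarrow> ('v, 'r::{comm_ring,comm_monoid_mult}) chain set"
  where
  "Theta G a b n =
     (if n \<ge> 1 then {w \<in> allowed_between G a b n. diff_between n w \<in> allowed_between G a b (n - 1)} else {0})"

text \<open>
  For \<open>n \<ge> 2\<close> the map strips the endpoints \<open>a\<close> and \<open>b\<close> from each basis sequence; for \<open>n = 1\<close> it
  sends \<open>r e\<^sub>a\<^sub>b\<close> to \<open>r\<close>.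
\<close>

definition proj_between ::
  "'v \<Rightarrow> 'v \<Rightarrow> int \<Rightarrow> ('v, 'r) chain \<Rightarrow> ('v, 'r::{comm_ring,comm_monoid_mult}) chain" where
  "proj_between a b n w =
     (if n \<ge> 2 then linear_extension (\<lambda>xs. elem_path (butlast (tl xs))) w
      else if n = 1 then ring_elem (Poly_Mapping.lookup w [a, b])
      else 0)"

end

theory Submission
  imports Defs
begin

text \<open>
  On sequences from \<open>a\<close> to \<open>b\<close>, stripping the endpoints turns the omission of position \<open>m + 1\<close>
  into the omission of position \<open>m\<close> and preserves allowedness. Hence \<open>\<pi>\<close> commutes with the
  differentials and maps allowed paths to allowed paths, and the preimage conditions defining
  \<open>\<Theta>\<close> and \<open>\<Pi>\<close> then match automatically. Only degrees 1 and 2 see the arrow \<open>a \<rightarrow> b\<close>: if it is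
  missing, there are no allowed 1-paths from \<open>a\<close> to \<open>b\<close>; if it is present, the differential of
  \<open>e\<^sub>a\<^sub>i\<^sub>b\<close> is \<open>e\<^sub>a\<^sub>b\<close>, which is the augmentation.
\<close>

section \<open>Linear algebra of finitely supported functions\<close>

lemma lookup_scale [simp]: "Poly_Mapping.lookup (scale r w) x = r * Poly_Mapping.lookup w x"
  unfolding scale_def by (simp add: Poly_Mapping.map.rep_eq when_def)

lemma scale_0_left [simp]: "scale 0 w = 0"
  by (rule poly_mapping_eqI) simp

lemma scale_0_right [simp]: "scale r 0 = 0"
  by (rule poly_mapping_eqI) simp

lemma scale_1 [simp]: "scale 1 w = w"
  by (rule poly_mapping_eqI) simp

lemma scale_scale [simp]: "scale r (scale s w) = scale (r * s) w"
  by (rule poly_mapping_eqI) (simp add: ac_simps)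

lemma scale_add_right: "scale r (v + w) = scale r v + scale r w"
  by (rule poly_mapping_eqI) (simp add: lookup_add distrib_left)

lemma scale_add_left: "scale (r + s) w = scale r w + scale s w"
  by (rule poly_mapping_eqI) (simp add: lookup_add distrib_right)

lemma scale_minus_left: "scale (- r) w = - scale r w"
  by (rule poly_mapping_eqI) simp

lemma scale_sum_right: "scale r (sum f A) = (\<Sum>x\<in>A. scale r (f x))"
  by (induction A rule: infinite_finite_induct) (simp_all add: scale_add_right)

lemma keys_scale: "Poly_Mapping.keys (scale r w) \<subseteq> Poly_Mapping.keys w"
  by (auto simp: in_keys_iff)

text \<open>Terms outside the support have coefficient 0. Chains with different supports, such as
  \<open>v\<close>, \<open>w\<close> and \<open>v + w\<close>, can thus be summed over one common
  index set.\<close>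

lemma linear_extension_superset:
  assumes "finite A" "Poly_Mapping.keys w \<subseteq> A"
  shows "linear_extension f w = (\<Sum>x\<in>A. scale (Poly_Mapping.lookup w x) (f x))"
  unfolding linear_extension_def
  by (rule sum.mono_neutral_left) (use assms in \<open>auto simp: in_keys_iff\<close>)

lemma linear_extension_cong:
  "(\<And>x. x \<in> Poly_Mapping.keys w \<Longrightarrow> f x = g x) \<Longrightarrow> linear_extension f w = linear_extension g w"
  unfolding linear_extension_def by (rule sum.cong) auto

lemma linear_extension_const_0 [simp]: "linear_extension (\<lambda>_. 0) w = 0"
  by (simp add: linear_extension_def)

lemma linear_extension_0 [simp]: "linear_extension f 0 = 0"
  by (simp add: linear_extension_def)

lemma linear_extension_add:
  "linear_extension f (v + w) = linear_extension f v + linear_extension f w"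
proof -
  let ?A = "Poly_Mapping.keys v \<union> Poly_Mapping.keys w"
  have "Poly_Mapping.keys (v + w) \<subseteq> ?A"
    by (rule keys_add)
  then show ?thesis
    by (simp add: linear_extension_superset[of ?A] lookup_add scale_add_left sum.distrib)
qed

lemma linear_extension_scale: "linear_extension f (scale r w) = scale r (linear_extension f w)"
  \<comment> \<open>Scaling by a zero divisor can shrink the support, so both sides are summed over
    the keys of \<open>w\<close>.\<close>
  using keys_scale[of r w]
  by (simp add: linear_extension_superset[of "Poly_Mapping.keys w"] scale_sum_right)

lemma linear_extension_sum:
  "linear_extension f (sum g A) = (\<Sum>x\<in>A. linear_extension f (g x))"
  by (induction A rule: infinite_finite_induct) (simp_all add: linear_extension_add)

lemma linear_extension_elem_path [simp]: "linear_extension f (elem_path xs) = f xs"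
  \<comment> \<open>In the zero ring \<open>elem_path xs\<close> is 0 and has no keys; the index set
    \<open>{xs}\<close> covers this case too.\<close>
  by (subst linear_extension_superset[of "{xs}"]) (auto simp: elem_path_def)

lemma linear_extension_linear_extension:
  "linear_extension g (linear_extension f w) = linear_extension (\<lambda>x. linear_extension g (f x)) w"
  by (simp add: linear_extension_def[of f] linear_extension_def[of "\<lambda>x. linear_extension g (f x)"]
      linear_extension_sum linear_extension_scale)

lemma keys_linear_extension_subset:
  assumes "\<And>x. x \<in> Poly_Mapping.keys w \<Longrightarrow> Poly_Mapping.keys (f x) \<subseteq> S"
  shows "Poly_Mapping.keys (linear_extension f w) \<subseteq> S"
proof -
  have "Poly_Mapping.keys (linear_extension f w)
      \<subseteq> (\<Union>x\<in>Poly_Mapping.keys w. Poly_Mapping.keys (scale (Poly_Mapping.lookup w x) (f x)))"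
    unfolding linear_extension_def by (rule keys_sum)
  also have "\<dots> \<subseteq> S"
    by (intro UN_least order.trans[OF keys_scale] assms)
  finally show ?thesis .
qed

lemma linear_map_linear_extension: "linear_map UNIV UNIV (linear_extension f)"
  by (simp add: linear_map_def linear_extension_add linear_extension_scale)

lemma linear_map_zero: "linear_map UNIV UNIV (\<lambda>_. 0)"
  by (simp add: linear_map_def)

lemma linear_map_UNIV_0:
  assumes "linear_map UNIV UNIV f"
  shows "f 0 = 0"
  using assms scale_0_left unfolding linear_map_def by (metis UNIV_I)

lemma is_submodule_supported: "is_submodule {w. Poly_Mapping.keys w \<subseteq> S}"
  by (simp add: is_submodule_def order.trans[OF keys_add] order.trans[OF keys_scale])

lemma linear_extension_elem_path_id: "linear_extension elem_path w = w"
proof (rule poly_mapping_eqI)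
  fix x
  have "Poly_Mapping.lookup (linear_extension elem_path w) x =
      (\<Sum>y\<in>Poly_Mapping.keys w. if y = x then Poly_Mapping.lookup w y else 0)"
    unfolding linear_extension_def elem_path_def lookup_sum
    by (rule sum.cong) (auto simp: lookup_single when_def)
  then show "Poly_Mapping.lookup (linear_extension elem_path w) x = Poly_Mapping.lookup w x"
    by (simp add: in_keys_iff)
qed

lemma is_submodule_sum:
  assumes "is_submodule M" "\<And>x. x \<in> A \<Longrightarrow> f x \<in> M"
  shows "sum f A \<in> M"
  using assms(2)
  by (induction A rule: infinite_finite_induct) (use assms(1) in \<open>auto simp: is_submodule_def\<close>)

text \<open>Chains supported in \<open>S\<close> form a submodule containing the generators, and
  each is a finite combination of generators. Membership in a module of allowed paths thus becomes a
  condition on supports.\<close>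

lemma generated_elem_path:
  "generated (elem_path ` S) =
     {w :: ('v, 'r::{comm_ring,comm_monoid_mult}) chain. Poly_Mapping.keys w \<subseteq> S}"
proof
  show "generated (elem_path ` S) \<subseteq> {w. Poly_Mapping.keys w \<subseteq> S}"
    unfolding generated_def
    by (rule hull_minimal) (auto simp: elem_path_def is_submodule_supported split: if_splits)
  show "{w :: ('v, 'r) chain. Poly_Mapping.keys w \<subseteq> S} \<subseteq> generated (elem_path ` S)"
  proof clarify
    fix w :: "('v, 'r) chain" assume w: "Poly_Mapping.keys w \<subseteq> S"
    have "linear_extension elem_path w \<in> M" if "is_submodule M" "elem_path ` S \<subseteq> M" for M
      unfolding linear_extension_def
      by (rule is_submodule_sum)
        (use that w in \<open>auto simp: is_submodule_def image_subset_iff subset_iff\<close>)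
    then show "w \<in> generated (elem_path ` S)"
      unfolding generated_def hull_def linear_extension_elem_path_id by blast
  qed
qed

section \<open>Subcomplexes cut out by a preimage condition\<close>

text \<open>If \<open>d n w\<close> lies in \<open>A (n - 1)\<close>, it satisfies the preimage
  condition itself, since its differential is 0. Stability of \<open>A\<close> under
  \<open>d\<close> is not asked for.\<close>

lemma chain_complex_preimage:
  assumes A: "\<And>n. is_submodule (A n)"
    and d: "\<And>n. linear_map UNIV UNIV (d n)"
    and dd: "\<And>n w. d (n - 1) (d n w) = 0"
  shows "chain_complex (\<lambda>n. {w \<in> A n. d n w \<in> A (n - 1)}) d"
proof -
  have "d n 0 = 0" "d n (v + w) = d n v + d n w" "d n (scale r w) = scale r (d n w)" for n r v w
    using d[of n] linear_map_UNIV_0[OF d] by (auto simp: linear_map_def)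
  then show ?thesis
    using A by (simp add: chain_complex_def is_submodule_def linear_map_def dd)
qed

text \<open>The preimage condition passes to \<open>f n w\<close> because its differential is the
  image under \<open>f (n - 1)\<close> of an element of \<open>A (n - 1)\<close>. Commutation is
  asked only on the subcomplex, which matters in degree 2 when the arrow is missing.\<close>

lemma chain_morphism_preimage:
  assumes C: "chain_complex (\<lambda>n. {w \<in> A n. d n w \<in> A (n - 1)}) d"
    and C': "chain_complex (\<lambda>n. {w \<in> A' n. d' n w \<in> A' (n - 1)}) d'"
    and f: "\<And>n. linear_map UNIV UNIV (f n)"
    and mem: "\<And>n w. w \<in> A n \<Longrightarrow> f n w \<in> A' (n + k)"
    and comm: "\<And>n w. w \<in> A n \<Longrightarrow> d n w \<in> A (n - 1) \<Longrightarrow> d' (n + k) (f n w) = f (n - 1) (d n w)"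
  shows "chain_morphism k (\<lambda>n. {w \<in> A n. d n w \<in> A (n - 1)}) d
           (\<lambda>n. {w \<in> A' n. d' n w \<in> A' (n - 1)}) d' f"
proof -
  have "f (n - 1) (d n w) \<in> A' (n + k - 1)" if "d n w \<in> A (n - 1)" for n w
    using mem[OF that] by (simp add: algebra_simps)
  moreover have "f n (v + w) = f n v + f n w" "f n (scale r w) = scale r (f n w)" for n r v w
    using f[of n] by (auto simp: linear_map_def)
  ultimately show ?thesis
    using C C' by (simp add: chain_morphism_def linear_map_def mem comm)
qed

section \<open>Alternating sums of omissions\<close>

text \<open>The offset \<open>k\<close> treats two differentials at once: 0 gives
  \<open>boundary\<close>, and 1 gives \<open>diff_between\<close>, which protects the first
  vertex.\<close>

definition omit_sum :: "nat \<Rightarrow> nat \<Rightarrow> 'v list \<Rightarrow> ('v, 'r::{comm_ring,comm_monoid_mult}) chain" where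
  "omit_sum k n xs = (\<Sum>m=0..n. scale ((-1) ^ m) (elem_path (omit (m + k) xs)))"

lemma omit_simps [simp]:
  "omit m [] = []" "omit 0 (x # xs) = xs" "omit (Suc m) (x # xs) = x # omit m xs"
  by (simp_all add: omit_def)

text \<open>The simplicial identity for face maps. It holds for lists of any length, since omitting
  a position beyond the end changes nothing.\<close>

lemma omit_omit:
  assumes "m \<le> l"
  shows "omit l (omit m xs) = omit m (omit (Suc l) xs)"
  using assms
proof (induction xs arbitrary: m l)
  case (Cons x xs)
  show ?case
  proof (cases m)
    case (Suc m')
    with Cons.prems obtain l' where "l = Suc l'" "m' \<le> l'"
      by (cases l) auto
    with Suc show ?thesis
      by (simp only: omit_simps Cons.IH[OF \<open>m' \<le> l'\<close>])
  qed simp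
qed simp

text \<open>The index pairs (m, l) with m \<le> l are matched with the remaining pairs (l + 1, m),
  and matched terms cancel.\<close>

lemma sum_simplicial_cancel:
  fixes h :: "nat \<Rightarrow> nat \<Rightarrow> 'a::ab_group_add"
  assumes "\<And>m l. m \<le> l \<Longrightarrow> h (Suc l) m = - h m l"
  shows "(\<Sum>m=0..Suc n. \<Sum>l=0..n. h m l) = 0"
proof (induction n)
  case 0
  show ?case
    using assms[of 0 0] by simp
next
  case (Suc n)
  \<comment> \<open>The larger rectangle adds the column \<open>l = Suc n\<close> and the row
    \<open>m = Suc (Suc n)\<close>, which are negatives of each other term by term.\<close>
  have "(\<Sum>m=0..Suc (Suc n). \<Sum>l=0..Suc n. h m l)
      = (\<Sum>m=0..Suc n. \<Sum>l=0..n. h m l) + (\<Sum>m=0..Suc n. h m (Suc n))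
        + (\<Sum>l=0..Suc n. h (Suc (Suc n)) l)"
    by (simp only: sum.atLeast0_atMost_Suc sum.distrib ac_simps)
  also have "(\<Sum>l=0..Suc n. h (Suc (Suc n)) l) = - (\<Sum>l=0..Suc n. h l (Suc n))"
    unfolding sum_negf[symmetric] by (rule sum.cong) (auto intro: assms)
  finally show ?case
    using Suc.IH by (simp only: add_0_left add.right_inverse)
qed

lemma linear_extension_omit_sum_omit_sum:
  fixes w :: "('v, 'r::{comm_ring,comm_monoid_mult}) chain"
  shows "linear_extension (omit_sum k n) (linear_extension (omit_sum k (Suc n)) w) = 0"
proof -
  have "linear_extension (omit_sum k n) (omit_sum k (Suc n) xs :: ('v, 'r) chain) = 0" for xs
  proof -
    define h :: "nat \<Rightarrow> nat \<Rightarrow> ('v, 'r) chain" where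
      "h m l = scale ((-1) ^ m * (-1) ^ l) (elem_path (omit (l + k) (omit (m + k) xs)))" for m l
    have "linear_extension (omit_sum k n) (omit_sum k (Suc n) xs) = (\<Sum>m=0..Suc n. \<Sum>l=0..n. h m l)"
      by (simp only: omit_sum_def[of k "Suc n"] linear_extension_sum linear_extension_scale
          linear_extension_elem_path omit_sum_def[of k n] scale_sum_right scale_scale h_def)
    also have "\<dots> = 0"
    proof (rule sum_simplicial_cancel)
      \<comment> \<open>Both sides omit the same two positions, by the simplicial identity shifted
        by \<open>k\<close>; the extra factor -1 comes from \<open>Suc l\<close>.\<close>
      show "h (Suc l) m = - h m l" if "m \<le> l" for m l
        using omit_omit[of "m + k" "l + k" xs] that
        by (simp add: h_def scale_minus_left mult.commute)
    qed
    finally show ?thesis .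
  qed
  then show ?thesis
    by (simp add: linear_extension_linear_extension)
qed

section \<open>The differentials: linearity and vanishing squares\<close>

lemma boundary_eq:
  "boundary n = (if n \<ge> 1 then linear_extension (omit_sum 0 (nat n)) else (\<lambda>_. 0))"
  by (rule ext) (simp add: boundary_def omit_sum_def[abs_def])

lemma diff_between_eq:
  "diff_between n = (if n \<ge> 2 then linear_extension (omit_sum 1 (nat (n - 2))) else (\<lambda>_. 0))"
  by (rule ext) (simp add: diff_between_def omit_sum_def[abs_def])

text \<open>As a linear extension, the augmentation obeys the same composition rule as the
  differentials in higher degrees.\<close>

lemma ring_elem_augmentation:
  "ring_elem (augmentation w) = linear_extension (\<lambda>_. elem_path []) w"
  by (rule poly_mapping_eqI)
    (auto simp: ring_elem_def augmentation_def linear_extension_def elem_path_def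
      lookup_single lookup_sum when_def)

lemma boundary_aug_eq:
  "boundary_aug n = (if n = 0 then linear_extension (\<lambda>_. elem_path []) else boundary n)"
  by (rule ext) (simp add: boundary_aug_def ring_elem_augmentation)

lemma linear_map_boundary: "linear_map UNIV UNIV (boundary n)"
  by (simp add: boundary_eq linear_map_linear_extension linear_map_zero)

lemma linear_map_boundary_aug: "linear_map UNIV UNIV (boundary_aug n)"
  by (simp add: boundary_aug_eq linear_map_linear_extension linear_map_boundary)

lemma linear_map_diff_between: "linear_map UNIV UNIV (diff_between n)"
  by (simp add: diff_between_eq linear_map_linear_extension linear_map_zero)

lemma boundary_boundary: "boundary (n - 1) (boundary n w) = 0"
proof (cases "n \<ge> 2")
  case True
  then have "nat n = Suc (nat (n - 1))"
    by simp
  with True show ?thesis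
    by (simp add: boundary_eq linear_extension_omit_sum_omit_sum)
qed (simp add: boundary_eq)

lemma diff_between_diff_between: "diff_between (n - 1) (diff_between n w) = 0"
proof (cases "n \<ge> 3")
  case True
  then have "nat (n - 2) = Suc (nat (n - 1 - 2))"
    by simp
  with True show ?thesis
    by (simp add: diff_between_eq linear_extension_omit_sum_omit_sum del: diff_diff_eq)
qed (simp add: diff_between_eq)

lemma boundary_aug_boundary_aug:
  fixes w :: "('v, 'r::{comm_ring,comm_monoid_mult}) chain"
  shows "boundary_aug (n - 1) (boundary_aug n w) = 0"
proof (cases "n = 1")
  case True
  \<comment> \<open>Both omissions go to the empty sequence, with signs 1 and -1.\<close>
  have "linear_extension (\<lambda>_. elem_path []) (omit_sum 0 (Suc 0) xs :: ('v, 'r) chain)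
      = (0 :: ('v, 'r) chain)" for xs
    by (simp add: omit_sum_def linear_extension_add linear_extension_scale del: mult_minus_left)
      (simp add: scale_minus_left)
  with True show ?thesis
    by (simp add: boundary_aug_eq boundary_eq linear_extension_linear_extension)
next
  case False
  then show ?thesis
    using boundary_boundary[of n w] by (auto simp: boundary_aug_eq boundary_eq)
qed

section \<open>The complexes and the projection\<close>

lemma allowed_paths_eq:
  "allowed_paths G n = {w. Poly_Mapping.keys w \<subseteq> {xs \<in> seqs (pverts G) n. allowed G xs}}"
  unfolding allowed_paths_def by (rule generated_elem_path)

lemma allowed_between_eq:
  "allowed_between G a b n =
     {w. Poly_Mapping.keys w \<subseteq> {xs \<in> seqs_between (pverts G) a b n. allowed G xs}}"
  unfolding allowed_between_def by (rule generated_elem_path)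

text \<open>Adding the multiples of the empty sequence in degree -1 brings the augmented complex
  into preimage form as well.\<close>

definition allowed_aug ::
  "'v pair_pre_digraph \<Rightarrow> int \<Rightarrow> ('v, 'r::{comm_ring,comm_monoid_mult}) chain set" where
  "allowed_aug G n = (if n = -1 then {w. Poly_Mapping.keys w \<subseteq> {[]}} else allowed_paths G n)"

lemma range_ring_elem:
  "range ring_elem = {w :: ('v, 'r::{comm_ring,comm_monoid_mult}) chain. Poly_Mapping.keys w \<subseteq> {[]}}"
proof
  show "{w :: ('v, 'r) chain. Poly_Mapping.keys w \<subseteq> {[]}} \<subseteq> range ring_elem"
  proof clarify
    fix w :: "('v, 'r) chain" assume w: "Poly_Mapping.keys w \<subseteq> {[]}"
    have "w = ring_elem (Poly_Mapping.lookup w [])"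
    proof (rule poly_mapping_eqI)
      show "Poly_Mapping.lookup w xs = Poly_Mapping.lookup (ring_elem (Poly_Mapping.lookup w [])) xs"
        for xs
        using w by (cases "xs = []") (auto simp: ring_elem_def lookup_single in_keys_iff)
    qed
    then show "w \<in> range ring_elem"
      by blast
  qed
qed (auto simp: ring_elem_def split: if_splits)

text \<open>Negative degrees take care of themselves: there are no sequences there, so only 0 is
  supported on them.\<close>

lemma Pi_cx_eq: "Pi_cx G = (\<lambda>n. {w \<in> allowed_paths G n. boundary n w \<in> allowed_paths G (n - 1)})"
  by (rule ext) (auto simp: Pi_cx_def allowed_paths_eq seqs_def boundary_eq)

lemma Theta_eq:
  "Theta G a b =
     (\<lambda>n. {w \<in> allowed_between G a b n. diff_between n w \<in> allowed_between G a b (n - 1)})"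
  by (rule ext) (auto simp: Theta_def allowed_between_eq seqs_between_def diff_between_eq)

text \<open>In degrees 0 and -1 the preimage condition is automatic: augmentations are multiples of
  the empty sequence, and the differential out of degree -1 vanishes.\<close>

lemma Pi_aug_eq:
  "Pi_aug G = (\<lambda>n. {w :: ('v, 'r::{comm_ring,comm_monoid_mult}) chain.
     w \<in> allowed_aug G n \<and> boundary_aug n w \<in> allowed_aug G (n - 1)})"
proof (rule ext)
  fix n :: int
  have "ring_elem r \<in> {w :: ('v, 'r) chain. Poly_Mapping.keys w \<subseteq> {[]}}" for r :: 'r
    using range_ring_elem by blast
  then show "Pi_aug G n =
      {w :: ('v, 'r) chain. w \<in> allowed_aug G n \<and> boundary_aug n w \<in> allowed_aug G (n - 1)}"
    by (auto simp: Pi_aug_def allowed_aug_def range_ring_elem Pi_cx_eq boundary_aug_def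
        allowed_paths_eq seqs_def boundary_eq)
qed

lemma chain_complex_Pi_cx: "chain_complex (Pi_cx G) boundary"
  unfolding Pi_cx_eq
  by (intro chain_complex_preimage linear_map_boundary boundary_boundary)
    (simp add: allowed_paths_eq is_submodule_supported)

lemma chain_complex_Pi_aug: "chain_complex (Pi_aug G) boundary_aug"
  unfolding Pi_aug_eq
  by (intro chain_complex_preimage linear_map_boundary_aug boundary_aug_boundary_aug)
    (simp add: allowed_aug_def allowed_paths_eq is_submodule_supported)

lemma chain_complex_Theta: "chain_complex (Theta G a b) diff_between"
  unfolding Theta_eq
  by (intro chain_complex_preimage linear_map_diff_between diff_between_diff_between)
    (simp add: allowed_between_eq is_submodule_supported)

section \<open>The projection: linearity, allowed paths, compatibility with differentials\<close>

lemma ring_elem_lookup: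
  "ring_elem (Poly_Mapping.lookup w ys) = linear_extension (\<lambda>xs. if xs = ys then elem_path [] else 0) w"
proof (rule poly_mapping_eqI)
  fix zs
  have "Poly_Mapping.lookup (linear_extension (\<lambda>xs. if xs = ys then elem_path [] else 0) w) zs
      = (\<Sum>x\<in>Poly_Mapping.keys w.
          if x = ys then Poly_Mapping.lookup (ring_elem (Poly_Mapping.lookup w x)) zs else 0)"
    unfolding linear_extension_def elem_path_def lookup_sum
    by (rule sum.cong) (auto simp: lookup_single when_def ring_elem_def)
  then show "Poly_Mapping.lookup (ring_elem (Poly_Mapping.lookup w ys)) zs =
      Poly_Mapping.lookup (linear_extension (\<lambda>xs. if xs = ys then elem_path [] else 0) w) zs"
    by (simp add: in_keys_iff ring_elem_def)
qed

text \<open>Reading off a coefficient in degree 1 is a linear extension too, so in every degree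
  compositions can be compared on basis sequences.\<close>

lemma proj_between_eq:
  "proj_between a b n =
     (if n \<ge> 2 then linear_extension (\<lambda>xs. elem_path (butlast (tl xs)))
      else if n = 1 then linear_extension (\<lambda>xs. if xs = [a, b] then elem_path [] else 0)
      else (\<lambda>_. 0))"
  by (rule ext) (simp add: proj_between_def ring_elem_lookup)

lemma linear_map_proj_between: "linear_map UNIV UNIV (proj_between a b n)"
  by (simp add: proj_between_eq linear_map_linear_extension linear_map_zero)

text \<open>Entries \<open>k\<close> and \<open>k + 1\<close> of the stripped sequence are entries
  \<open>k + 1\<close> and \<open>k + 2\<close> of \<open>xs\<close>.\<close>

lemma allowed_butlast_tl:
  assumes "allowed G xs"
  shows "allowed G (butlast (tl xs))"
  unfolding allowed_def
proof clarify
  fix k assume "Suc k < length (butlast (tl xs))"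
  then show "(butlast (tl xs) ! k, butlast (tl xs) ! Suc k) \<in> parcs G"
    using assms[unfolded allowed_def, rule_format, of "Suc k"] by (simp add: nth_butlast nth_tl)
qed

lemma butlast_tl_mem_seqs:
  assumes "xs \<in> seqs V n" "n \<ge> 2"
  shows "butlast (tl xs) \<in> seqs V (n - 2)"
  using assms by (auto simp: seqs_def dest!: in_set_butlastD list.set_sel(2)[rotated])

lemma proj_between_mem_allowed_paths:
  fixes w :: "('v, 'r::{comm_ring,comm_monoid_mult}) chain"
  assumes "w \<in> allowed_between G a b n" "n \<ge> 2"
  shows "proj_between a b n w \<in> allowed_paths G (n - 2)"
proof -
  have "Poly_Mapping.keys (elem_path (butlast (tl xs)) :: (_, 'r) chain)
      \<subseteq> {xs \<in> seqs (pverts G) (n - 2). allowed G xs}"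
    if "xs \<in> Poly_Mapping.keys w" for xs
    using that assms butlast_tl_mem_seqs[of xs "pverts G" n] allowed_butlast_tl[of G xs]
    by (auto simp: allowed_between_eq seqs_between_def elem_path_def)
  then show ?thesis
    using assms(2) by (simp add: allowed_paths_eq proj_between_eq keys_linear_extension_subset)
qed

text \<open>This is how the missing arrow enters: an allowed 1-chain has coefficient 0 at
  \<open>[a, b]\<close>, so nothing reaches degree -1.\<close>

lemma proj_between_1_eq_0:
  assumes "w \<in> allowed_between G a b 1" "(a, b) \<notin> parcs G"
  shows "proj_between a b 1 w = 0"
proof -
  have "\<not> allowed G [a, b]"
    using assms(2) by (auto simp: allowed_def)
  then have "[a, b] \<notin> Poly_Mapping.keys w"
    using assms(1) by (auto simp: allowed_between_eq)
  then show ?thesis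
    by (simp add: proj_between_def ring_elem_def in_keys_iff)
qed

text \<open>The length bound ensures that position \<open>m + 1\<close> is not the last, so the
  omission leaves both endpoints for stripping.\<close>

lemma butlast_tl_omit:
  assumes "Suc (Suc m) < length xs"
  shows "butlast (tl (omit (Suc m) xs)) = omit m (butlast (tl xs))"
  using assms by (cases xs) (auto simp: omit_def butlast_append take_butlast drop_butlast)

lemma boundary_proj_between:
  assumes "w \<in> allowed_between G a b n" "n \<ge> 3"
  shows "boundary (n - 2) (proj_between a b n w) = proj_between a b (n - 1) (diff_between n w)"
proof -
  have "omit_sum 0 (nat (n - 2)) (butlast (tl xs))
      = linear_extension (\<lambda>xs. elem_path (butlast (tl xs))) (omit_sum 1 (nat (n - 2)) xs)"
    if "xs \<in> Poly_Mapping.keys w" for xs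
  proof -
    have "int (length xs) = n + 1"
      using that assms(1) by (auto simp: allowed_between_eq seqs_between_def seqs_def)
    \<comment> \<open>The length is \<open>n + 1\<close> and \<open>m + 2\<close> is at most
      \<open>n\<close>, so only interior vertices are omitted.\<close>
    then have "butlast (tl (omit (Suc m) xs)) = omit m (butlast (tl xs))" if "m \<le> nat (n - 2)" for m
      using that assms(2) by (intro butlast_tl_omit) linarith
    then show ?thesis
      by (simp add: omit_sum_def linear_extension_sum linear_extension_scale)
  qed
  then show ?thesis
    using assms(2)
    by (simp add: boundary_eq proj_between_eq diff_between_eq linear_extension_linear_extension
        del: One_nat_def)
      (auto intro: linear_extension_cong)
qed

lemma boundary_aug_proj_between_2:
  assumes "w \<in> allowed_between G a b 2"
  shows "boundary_aug 0 (proj_between a b 2 w) = proj_between a b 1 (diff_between 2 w)"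
proof -
  \<comment> \<open>Omitting the single interior vertex leaves \<open>[a, b]\<close>, so both sides
    send every basis sequence to the empty one.\<close>
  have "omit (Suc 0) xs = [a, b]" if "xs \<in> Poly_Mapping.keys w" for xs
  proof -
    have "length xs = 3" "hd xs = a" "last xs = b"
      using that assms by (auto simp: allowed_between_eq seqs_between_def seqs_def)
    then show ?thesis
      by (auto simp: omit_def numeral_3_eq_3 length_Suc_conv)
  qed
  then show ?thesis
    by (auto simp: boundary_aug_eq proj_between_eq diff_between_eq omit_sum_def
        linear_extension_linear_extension intro!: linear_extension_cong)
qed

theorem theorem5p8:
  fixes G :: "'v pair_pre_digraph" and a b :: 'v
  assumes "pair_digraph G" and "a \<in> pverts G" and "b \<in> pverts G"
  shows "((a, b) \<notin> parcs G \<longrightarrow>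
            chain_morphism (-2) (Theta G a b) diff_between (Pi_cx G) boundary
              (proj_between a b ::
                 int \<Rightarrow> ('v, 'r) chain \<Rightarrow> ('v, 'r::{comm_ring,comm_monoid_mult}) chain)) \<and>
         ((a, b) \<in> parcs G \<longrightarrow>
            chain_morphism (-2) (Theta G a b) diff_between (Pi_aug G) boundary_aug
              (proj_between a b :: int \<Rightarrow> ('v, 'r) chain \<Rightarrow> ('v, 'r) chain))"
proof (intro conjI impI)
  assume no_arrow: "(a, b) \<notin> parcs G"
  show "chain_morphism (-2) (Theta G a b) diff_between (Pi_cx G) boundary
      (proj_between a b :: int \<Rightarrow> ('v, 'r) chain \<Rightarrow> ('v, 'r) chain)"
    unfolding Theta_eq Pi_cx_eq
  proof (intro chain_morphism_preimage chain_complex_Theta[unfolded Theta_eq]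
      chain_complex_Pi_cx[unfolded Pi_cx_eq] linear_map_proj_between)
    fix n and w :: "('v, 'r) chain"
    assume w: "w \<in> allowed_between G a b n"
    consider "n \<ge> 2" | "n = 1" | "n \<le> 0"
      by linarith
    then show "proj_between a b n w \<in> allowed_paths G (n + -2)"
      using w no_arrow proj_between_mem_allowed_paths[of w G a b n] proj_between_1_eq_0[of w G a b]
      by cases (auto simp: allowed_paths_eq proj_between_eq)
    assume dw: "diff_between n w \<in> allowed_between G a b (n - 1)"
    consider "n \<ge> 3" | "n = 2" | "n \<le> 1"
      by linarith
    then show "boundary (n + -2) (proj_between a b n w) = proj_between a b (n - 1) (diff_between n w)"
    proof cases
      case 1
      then show ?thesis
        using boundary_proj_between[OF w] by simp
    next
      case 2
      \<comment> \<open>The target differential out of degree 0 is zero. The other side vanishes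
        because \<open>dw\<close> makes the differential of \<open>w\<close> an allowed
        1-chain.\<close>
      then show ?thesis
        using proj_between_1_eq_0[of "diff_between n w" G a b] dw no_arrow by (simp add: boundary_eq)
    next
      case 3
      then show ?thesis
        by (simp add: boundary_eq diff_between_eq proj_between_eq)
    qed
  qed
next
  show "chain_morphism (-2) (Theta G a b) diff_between (Pi_aug G) boundary_aug
      (proj_between a b :: int \<Rightarrow> ('v, 'r) chain \<Rightarrow> ('v, 'r) chain)"
    unfolding Theta_eq Pi_aug_eq
  proof (intro chain_morphism_preimage chain_complex_Theta[unfolded Theta_eq]
      chain_complex_Pi_aug[unfolded Pi_aug_eq] linear_map_proj_between)
    fix n and w :: "('v, 'r) chain"
    assume w: "w \<in> allowed_between G a b n"
    consider "n \<ge> 2" | "n = 1" | "n \<le> 0"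
      by linarith
    then show "proj_between a b n w \<in> allowed_aug G (n + -2)"
      using w proj_between_mem_allowed_paths[of w G a b n]
      \<comment> \<open>In degree 1 the value is a ring element, and the target in degree -1
        contains all of these.\<close>
      by cases (auto simp: allowed_aug_def allowed_paths_eq proj_between_def ring_elem_def
          split: if_splits)
    consider "n \<ge> 3" | "n = 2" | "n \<le> 1"
      by linarith
    then show "boundary_aug (n + -2) (proj_between a b n w) = proj_between a b (n - 1) (diff_between n w)"
    proof cases
      case 1
      then show ?thesis
        using boundary_proj_between[OF w] by (simp add: boundary_aug_def)
    next
      case 2
      then show ?thesis
        using boundary_aug_proj_between_2[of w G a b] w by simp
    next
      case 3
      then show ?thesis
        by (simp add: boundary_aug_eq boundary_eq diff_between_eq proj_between_eq)
    qed
  qed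
qed

end
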